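(* Let $\mathbb{R}^n$ be endowed with the Euclidean norm and let $\mathcal{C}\subseteq\mathbb{R}^n$ be a simplex-like polytope with at least two points. Then the facial distance of $\mathcal{C}$ satisfies $$\Phi(\mathcal{C})\ \ge\ \frac{1}{\sqrt{n}}.$$
   Context: A polytope $\mathcal{C}\subseteq\mathbb{R}^n$ is simplex-like if it is of the form $\mathcal{C}=\{x\in\mathbb{R}^n : Ax=b,\ x\ge 0\}$ for some matrix $A$ and vector $b$ (with $x\ge0$ componentwise) and all its vertices lie in $\{0,1\}^n$. $\mathrm{vert}(\mathcal{C})$ is the set of vertices of $\mathcal{C}$ and $\mathrm{faces}(\mathcal{C})$ is the set of nonempty faces (including $\mathcal{C}$ itself). For $G\in\mathrm{faces}(\mathcal{C})$, $G\neq\mathcal{C}$, $\mathcal{C}[G]:=\mathrm{conv}(\mathrm{vert}(\mathcal{C})\setminus G)$. For sets $S,T$, $\mathrm{dist}(S,T)=\min_{x\in S,\,y\in T}\|x-y\|$. The facial distance of $\mathcal{C}$ is $\Phi(\mathcal{C}):=\min_{G\in\mathrm{faces}(\mathcal{C}),\ G\subsetneq\mathcal{C}}\mathrm{dist}(G,\mathcal{C}[G])$. *)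

theory Defs
  imports "HOL-Analysis.Analysis"
begin

definition vert :: "(real ^ 'n) set \<Rightarrow> (real ^ 'n) set" where
  "vert C = {v. v extreme_point_of C}"

text \<open>
  A polytope \<open>C = {x. A x = b, x \<ge> 0}\<close> with 0/1 vertices.  The representing data \<open>A\<close>, \<open>b\<close> are
  parameters because the number of rows is the type \<open>'m\<close>, which cannot be quantified existentially
  inside a definition.
\<close>
definition simplex_like :: "real ^ 'n ^ 'm \<Rightarrow> real ^ 'm \<Rightarrow> (real ^ 'n) set \<Rightarrow> bool" where
  "simplex_like A b C \<longleftrightarrow>
     polytope C \<and>
     C = {x. A *v x = b \<and> (\<forall>i. 0 \<le> x $ i)} \<and>
     (\<forall>v \<in> vert C. \<forall>i. v $ i \<in> {0, 1})"

text \<open>\<open>face_of\<close> admits the empty face, which is excluded here.\<close>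
definition faces :: "(real ^ 'n) set \<Rightarrow> (real ^ 'n) set set" where
  "faces C = {G. G face_of C \<and> G \<noteq> {}}"

definition compl_hull :: "(real ^ 'n) set \<Rightarrow> (real ^ 'n) set \<Rightarrow> (real ^ 'n) set" where
  "compl_hull C G = convex hull (vert C - G)"

text \<open>
  For a polytope \<open>C\<close> with at least two points, the minimum ranges over a finite nonempty set, and
  \<open>G\<close> and \<open>compl_hull C G\<close> are nonempty and compact for every proper nonempty face \<open>G\<close>, so the
  infimum in \<open>setdist\<close> is attained.  For a single point there is no such face, and the value is
  unspecified.
\<close>
definition facial_distance :: "(real ^ 'n) set \<Rightarrow> real" where
  "facial_distance C = Min ((\<lambda>G. setdist G (compl_hull C G)) ` {G \<in> faces C. G \<subset> C})"

end

theory Submission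
  imports Defs
begin

text \<open>
  A proper nonempty face \<open>G\<close> of \<open>C = {x. A x = b, x \<ge> 0}\<close> is cut out of \<open>C\<close> by the equations
  \<open>x\<^sub>i = 0\<close> for \<open>i\<close> in the set \<open>I\<close> of coordinates vanishing on all of \<open>G\<close>
  (\<open>face_of_nonneg_affine_eq\<close>).  The linear functional \<open>s x = (\<Sum>i\<in>I. x\<^sub>i)\<close> therefore vanishes on
  \<open>G\<close>, whereas a vertex outside \<open>G\<close> has a nonzero coordinate in \<open>I\<close>, which must be 1, so that
  \<open>s \<ge> 1\<close> on the convex hull of these vertices.  The functional \<open>s\<close> is the inner product with the
  indicator vector of \<open>I\<close>, whose norm is at most \<open>\<surd>n\<close>, so by Cauchy--Schwarz any two points on
  which the values of \<open>s\<close> differ by at least 1 have distance at least \<open>1 / \<surd>n\<close>.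
\<close>

text \<open>
  For each coordinate choose a point of \<open>G\<close> where it is positive, if there is one; nonnegativity
  prevents cancellation in the average of these points.
\<close>
lemma convex_nonneg_ex_maximal_support:
  fixes G :: "(real ^ 'n) set"
  assumes "convex G" "G \<noteq> {}" and nonneg: "\<And>x i. x \<in> G \<Longrightarrow> 0 \<le> x $ i"
  obtains g where "g \<in> G" "\<And>i y. y \<in> G \<Longrightarrow> y $ i \<noteq> 0 \<Longrightarrow> 0 < g $ i"
proof -
  have "\<forall>i. \<exists>p\<in>G. (\<exists>y\<in>G. y $ i \<noteq> 0) \<longrightarrow> p $ i \<noteq> 0"
    using \<open>G \<noteq> {}\<close> by blast
  then obtain p where p: "\<And>i. p i \<in> G" "\<And>i y. y \<in> G \<Longrightarrow> y $ i \<noteq> 0 \<Longrightarrow> p i $ i \<noteq> 0"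
    by metis
  define g where "g = (\<Sum>i\<in>UNIV. (1 / real CARD('n)) *\<^sub>R p i)"
  have "g \<in> G"
    unfolding g_def by (rule convex_sum) (use \<open>convex G\<close> p(1) in auto)
  moreover have "0 < g $ i" if "y \<in> G" "y $ i \<noteq> 0" for i y
  proof -
    have "0 < p i $ i"
      using p(2)[OF that] nonneg[OF p(1), of i i] by simp
    then have "0 < (\<Sum>j\<in>UNIV. (1 / real CARD('n)) * p j $ i)"
      by (intro sum_pos2[where i = i]) (auto simp: nonneg p(1))
    then show ?thesis
      by (simp add: g_def)
  qed
  ultimately show ?thesis
    by (rule that)
qed

text \<open>
  If the support of \<open>x\<close> is contained in that of \<open>g\<close>, the segment from \<open>x\<close> to \<open>g\<close> can be
  prolonged a little beyond \<open>g\<close> without leaving the nonnegative orthant.  This makes \<open>g\<close> an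
  inner point of a segment in the polyhedron, so every face containing \<open>g\<close> contains \<open>x\<close>.
\<close>
lemma face_of_nonneg_affine_support:
  fixes A :: "real ^ 'n ^ 'm"
  assumes face: "G face_of C" and C: "C = {x. A *v x = b \<and> (\<forall>i. 0 \<le> x $ i)}"
    and "g \<in> G" "x \<in> C" and supp: "\<And>i. x $ i \<noteq> 0 \<Longrightarrow> 0 < g $ i"
  shows "x \<in> G"
proof (cases "x = g")
  case False
  have "g \<in> C"
    using face \<open>g \<in> G\<close> face_of_imp_subset by blast
  have x_nonneg: "0 \<le> x $ i" and g_nonneg: "0 \<le> g $ i" for i
    using \<open>x \<in> C\<close> \<open>g \<in> C\<close> C by auto
  \<comment> \<open>The step \<open>d\<close> is the smallest relevant ratio \<open>g\<^sub>i / x\<^sub>i\<close>, with 1 added to the denominators to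
    keep them positive; inserting 1 makes the set nonempty.\<close>
  define d where "d = Min (insert 1 ((\<lambda>i. g $ i / (1 + x $ i)) ` {i. 0 < g $ i}))"
  have "0 < d"
    unfolding d_def by (auto simp: add_pos_nonneg x_nonneg)
  have d_le: "d * x $ i \<le> g $ i" for i
  proof (cases "x $ i = 0")
    case True
    then show ?thesis using g_nonneg by simp
  next
    case False
    then have "d \<le> g $ i / (1 + x $ i)"
      unfolding d_def by (intro Min_le) (auto dest: supp)
    then have "d * (1 + x $ i) \<le> g $ i"
      using x_nonneg[of i] by (simp add: pos_le_divide_eq)
    then show ?thesis
      using \<open>0 < d\<close> by (simp add: distrib_left)
  qed
  define z where "z = g + d *\<^sub>R (g - x)"
  have "A *v z = b"
    using \<open>x \<in> C\<close> \<open>g \<in> C\<close> C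
    by (simp add: z_def matrix_vector_right_distrib matrix_vector_mult_scaleR
        matrix_vector_mult_diff_distrib)
  moreover have "0 \<le> z $ i" for i
  proof -
    have "0 \<le> d * g $ i"
      using \<open>0 < d\<close> g_nonneg[of i] by simp
    then show ?thesis
      unfolding z_def vector_add_component vector_scaleR_component vector_minus_component
        real_scaleR_def right_diff_distrib
      using d_le[of i] by linarith
  qed
  ultimately have "z \<in> C"
    using C by simp
  have "z - x = (1 + d) *\<^sub>R (g - x)"
    by (simp add: z_def algebra_simps)
  then have "z \<noteq> x" and "g - x = (1 / (1 + d)) *\<^sub>R (z - x)"
    using False \<open>0 < d\<close> by auto
  then have "g = (1 - 1 / (1 + d)) *\<^sub>R x + (1 / (1 + d)) *\<^sub>R z"
    by (simp add: algebra_simps)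
  moreover have "0 < 1 / (1 + d)" "1 / (1 + d) < 1"
    using \<open>0 < d\<close> by auto
  ultimately have "g \<in> open_segment x z"
    using \<open>z \<noteq> x\<close> unfolding in_segment by blast
  then show ?thesis
    using face_ofD[OF face] \<open>x \<in> C\<close> \<open>z \<in> C\<close> \<open>g \<in> G\<close> by blast
qed (use \<open>g \<in> G\<close> in simp)

lemma face_of_nonneg_affine_eq:
  fixes A :: "real ^ 'n ^ 'm"
  assumes face: "G face_of C" and C: "C = {x. A *v x = b \<and> (\<forall>i. 0 \<le> x $ i)}"
    and "G \<noteq> {}"
  shows "G = {x \<in> C. \<forall>i. (\<forall>y\<in>G. y $ i = 0) \<longrightarrow> x $ i = 0}"
proof -
  have "G \<subseteq> C"
    using face by (rule face_of_imp_subset)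
  obtain g where "g \<in> G" and g: "\<And>i y. y \<in> G \<Longrightarrow> y $ i \<noteq> 0 \<Longrightarrow> 0 < g $ i"
    using convex_nonneg_ex_maximal_support[OF face_of_imp_convex[OF face] \<open>G \<noteq> {}\<close>]
      \<open>G \<subseteq> C\<close> C by blast
  have "x \<in> G" if "x \<in> C" "\<forall>i. (\<forall>y\<in>G. y $ i = 0) \<longrightarrow> x $ i = 0" for x
    using face_of_nonneg_affine_support[OF face C \<open>g \<in> G\<close> \<open>x \<in> C\<close>] g that(2) by blast
  then show ?thesis
    using \<open>G \<subseteq> C\<close> by auto
qed

lemma setdist_face_compl_hull_ge:
  fixes A :: "real ^ 'n ^ 'm"
  assumes "simplex_like A b C" "G face_of C" "G \<noteq> {}" "G \<noteq> C"
  shows "1 / sqrt (real CARD('n)) \<le> setdist G (compl_hull C G)"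
proof -
  have "polytope C" and C: "C = {x. A *v x = b \<and> (\<forall>i. 0 \<le> x $ i)}"
    and vert01: "\<And>v i. v \<in> vert C \<Longrightarrow> v $ i \<in> {0, 1}"
    using assms(1) unfolding simplex_like_def by auto
  have "C = convex hull (vert C)"
    unfolding vert_def
    using \<open>polytope C\<close> by (intro Krein_Milman_Minkowski polytope_imp_compact polytope_imp_convex)
  then have "\<not> vert C \<subseteq> G"
    using assms(2,4) face_of_imp_convex face_of_imp_subset hull_minimal by (metis subset_antisym)
  then have "compl_hull C G \<noteq> {}"
    by (auto simp: compl_hull_def)
  define I where "I = {i. \<forall>y\<in>G. y $ i = 0}"
  define a :: "real ^ 'n" where "a = (\<chi> i. if i \<in> I then 1 else 0)"
  have a_inner: "a \<bullet> x = (\<Sum>i\<in>I. x $ i)" for x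
    by (simp add: a_def inner_vec_def if_distrib[of "\<lambda>c. c * _"] sum.If_cases)
  have norm_a: "norm a \<le> sqrt (real CARD('n))"
    by (simp add: norm_eq_sqrt_inner a_inner) (simp add: a_def card_mono)
  have "vert C - G \<subseteq> {x. a \<bullet> x \<ge> 1}"
  proof
    fix v assume v: "v \<in> vert C - G"
    then have "v \<in> C"
      by (auto simp: vert_def extreme_point_of_def)
    then obtain i where "i \<in> I" "v $ i \<noteq> 0"
      using v face_of_nonneg_affine_eq[OF assms(2) C assms(3)] by (auto simp: I_def)
    then have "1 = v $ i"
      using v vert01[of v i] by auto
    also have "\<dots> \<le> (\<Sum>i\<in>I. v $ i)"
      using \<open>i \<in> I\<close> \<open>v \<in> C\<close> C by (intro member_le_sum) auto
    finally show "v \<in> {x. a \<bullet> x \<ge> 1}"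
      by (simp add: a_inner)
  qed
  then have hull: "compl_hull C G \<subseteq> {x. a \<bullet> x \<ge> 1}"
    unfolding compl_hull_def by (rule hull_minimal) (rule convex_halfspace_ge)
  have "1 / sqrt (real CARD('n)) \<le> dist x y" if "x \<in> G" "y \<in> compl_hull C G" for x y
  proof -
    have "a \<bullet> x = 0"
      using \<open>x \<in> G\<close> by (simp add: a_inner I_def)
    then have "1 \<le> a \<bullet> (y - x)"
      using hull \<open>y \<in> compl_hull C G\<close> by (auto simp: inner_diff_right)
    also have "\<dots> \<le> norm a * norm (y - x)"
      by (rule norm_cauchy_schwarz)
    also have "\<dots> \<le> sqrt (real CARD('n)) * dist x y"
      using norm_a by (simp add: dist_norm norm_minus_commute mult_right_mono)
    finally show ?thesis
      by (simp add: pos_divide_le_eq mult.commute)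
  qed
  then show ?thesis
    using \<open>G \<noteq> {}\<close> \<open>compl_hull C G \<noteq> {}\<close> by (intro le_setdistI) auto
qed

text \<open>
  Since \<open>Min\<close> is meaningful only on finite nonempty sets, it remains to see that there are finitely
  many faces, and that a singleton face at a vertex is proper as soon as \<open>C\<close> has two points.
\<close>
theorem mainTheorem5:
  fixes A :: "real ^ 'n ^ 'm" and b :: "real ^ 'm" and C :: "(real ^ 'n) set"
  assumes "simplex_like A b C"
    and "\<exists>x\<in>C. \<exists>y\<in>C. x \<noteq> y"
  shows "facial_distance C \<ge> 1 / sqrt (real CARD('n))"
proof -
  let ?F = "{G \<in> faces C. G \<subset> C}"
  have "polytope C"
    using assms(1) unfolding simplex_like_def by auto
  then have "finite ?F"
    by (auto simp: faces_def intro: finite_subset[OF _ finite_polytope_faces])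
  moreover obtain v where "v extreme_point_of C"
    using \<open>polytope C\<close> assms(2) extreme_point_exists_convex
      polytope_imp_compact polytope_imp_convex by blast
  then have "{v} face_of C" "{v} \<subset> C"
    using assms(2) by (auto simp: face_of_singleton extreme_point_of_def)
  then have "?F \<noteq> {}"
    by (auto simp: faces_def)
  ultimately show ?thesis
    unfolding facial_distance_def
    by (subst Min_ge_iff) (auto simp: faces_def intro!: setdist_face_compl_hull_ge[OF assms(1)])
qed

end
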